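(* For any integer $k$, every oriented graph $D$ with $\delta^{0}(D)>k/2$ contains a copy of $P(s,t)$ for all non-negative integers $s,t$ with $s+t=k$.
   Context: All digraphs are finite, with non-empty vertex set, and have no loops or parallel arcs (no two arcs with the same tail and the same head). An oriented graph is a digraph without directed cycles of length two, i.e. for distinct vertices $u,v$ at most one of $(u,v)$, $(v,u)$ is an arc. For an arc $(u,v)$ of $D$, write $u\rightarrow v$. The out-degree (resp. in-degree) of a vertex $v$ is the number of vertices $u$ with $v\rightarrow u$ (resp. $u\rightarrow v$). $\delta^{+}(D)$ and $\delta^{-}(D)$ denote the minimum out-degree and minimum in-degree of $D$ over all its vertices, and the minimum semi-degree is $\delta^{0}(D)=\min\{\delta^{+}(D),\delta^{-}(D)\}$. For non-negative integers $s,t$, $P(s,t)$ is the oriented path consisting of $s$ consecutive forward arcs followed by $t$ consecutive backward arcs, i.e. the oriented graph on $s+t+1$ distinct vertices $u_0,u_1,\dots,u_{s+t}$ whose arcs are exactly $u_{i-1}\rightarrow u_i$ for $1\le i\le s$ and $u_{i}\rightarrow u_{i-1}$ for $s+1\le i\le s+t$. A digraph $D$ contains a copy of $P(s,t)$ if it has a (not necessarily induced) subdigraph isomorphic to $P(s,t)$. *)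

theory Defs
  imports Complex_Main "Graph_Theory.Graph_Theory"
begin

text \<open>The locale \<^locale>\<open>digraph\<close> already provides finiteness and excludes loops and
  parallel arcs, but it admits the null graph.\<close>

locale oriented_graph = digraph +
  assumes verts_nonempty: "verts G \<noteq> {}"
    and no_two_cycle: "\<lbrakk>u \<noteq> v; u \<rightarrow> v\<rbrakk> \<Longrightarrow> \<not> v \<rightarrow> u"

text \<open>The library counts incident arcs; without parallel arcs this is the number of out- or
  in-neighbours.\<close>

lemma (in digraph) out_degree_eq_card_neighbours: "out_degree G v = card {u. v \<rightarrow> u}"
proof -
  have "{u. v \<rightarrow> u} = head G ` out_arcs G v"
    by (auto simp: arcs_ends_conv out_arcs_def)
  moreover have "inj_on (head G) (out_arcs G v)"
    by (auto intro!: inj_onI no_multi_arcs simp: arc_to_ends_def)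
  ultimately show ?thesis
    by (simp add: out_degree_def card_image)
qed

lemma (in digraph) in_degree_eq_card_neighbours: "in_degree G v = card {u. u \<rightarrow> v}"
proof -
  have "{u. u \<rightarrow> v} = tail G ` in_arcs G v"
    by (auto simp: arcs_ends_conv in_arcs_def)
  moreover have "inj_on (tail G) (in_arcs G v)"
    by (auto intro!: inj_onI no_multi_arcs simp: arc_to_ends_def)
  ultimately show ?thesis
    by (simp add: in_degree_def card_image)
qed

text \<open>These minima are meaningful only for a finite, non-empty vertex set.\<close>

definition min_out_degree :: "('a, 'b) pre_digraph \<Rightarrow> nat" where
  "min_out_degree D = Min (out_degree D ` verts D)"

definition min_in_degree :: "('a, 'b) pre_digraph \<Rightarrow> nat" where
  "min_in_degree D = Min (in_degree D ` verts D)"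

definition min_semi_degree :: "('a, 'b) pre_digraph \<Rightarrow> nat" where
  "min_semi_degree D = min (min_out_degree D) (min_in_degree D)"

text \<open>The path $P(s,t)$, with the vertex $u_i$ represented by the number $i$ and an arc by the
  pair of its tail and its head.\<close>

definition P_path :: "nat \<Rightarrow> nat \<Rightarrow> (nat, nat \<times> nat) pre_digraph" where
  "P_path s t = \<lparr> verts = {0..s + t},
     arcs = {(i - 1, i) | i. 1 \<le> i \<and> i \<le> s} \<union> {(i, i - 1) | i. s + 1 \<le> i \<and> i \<le> s + t},
     tail = fst, head = snd \<rparr>"

lemma oriented_graph_P_path: "oriented_graph (P_path s t)"
proof -
  have "arcs (P_path s t) \<subseteq> {0..s + t} \<times> {0..s + t}"
    by (auto simp: P_path_def)
  then have "finite (arcs (P_path s t))"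
    by (rule finite_subset) simp
  then show ?thesis
    by unfold_locales (auto simp: P_path_def arc_to_ends_def arcs_ends_conv)
qed

definition contains_copy :: "('a, 'b) pre_digraph \<Rightarrow> ('c, 'd) pre_digraph \<Rightarrow> bool" where
  "contains_copy D F \<longleftrightarrow> (\<exists>H. subgraph H D \<and> digraph_iso F H)"

end

theory Submission
  imports Defs
begin

text \<open>
  Let $d$ be the minimum semi-degree. It suffices to find $P(s,t)$ with $s + t = 2d - 1$ and $t <
  s$, because shorter paths are subpaths of these and $P(s,t)$ and $P(t,s)$ are isomorphic.

  The source of copies is the chord criterion \<open>two_block_path_of_chord\<close>: if the last
  vertex of a directed path with $n$ vertices sends an arc back to position $x$, then $P(s,t)$ is
  present as soon as $s \le x < n - t$, or $t \le x < n - s$. In a counterexample, the arcs from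
  the last vertex of a path back to the path thus avoid two intervals of positions. If the path is
  longest, all out-neighbours of its last vertex are on the path, and likewise all in-neighbours
  of its first vertex, at least $d$ in each case.

  The criterion is strong because a longest path can be rotated into many others. If the path
  closes up to a cycle, all rotations are longest paths, and one vertex already has too few
  positions left for its $2d$ neighbours (\<open>hamiltonian_cycle_two_block\<close>). Otherwise
  choose the longest path whose last vertex sends an arc as far back as possible, to position $b >
  0$. The path then consists of a stem of $b$ vertices leading into a long cycle. Each
  in-neighbour on the cycle of the first stem vertex $z$ allows running through the cycle first
  and through the stem afterwards; all these longest paths end in the last stem vertex $y$.
  Minimality of $b$ and the chord criterion therefore forbid, relative to each in-neighbour of
  $z$, two intervals of positions on the cycle for the out-neighbours of $y$. What remains is
  additive combinatorics in a cyclic group: the two neighbourhoods on the cycle are too large to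
  avoid each other in this way (\<open>period_card_window_le\<close> and
  \<open>two_windows\<close>).
\<close>

section \<open>Interval sumsets in cyclic groups\<close>

text \<open>Subsets of the cyclic group of order $L$ are represented by their periodic preimages
  in the integers. A gap between two consecutive elements is then an honest integer interval, and
  no modular arithmetic is needed when intervals are shifted.\<close>

definition periodic :: "int \<Rightarrow> int set \<Rightarrow> bool" where
  "periodic L A \<longleftrightarrow> (\<forall>k. k + L \<in> A \<longleftrightarrow> k \<in> A)"

definition period_card :: "int \<Rightarrow> int set \<Rightarrow> int" where
  "period_card L A = int (card (A \<inter> {0..<L}))"

lemma periodic_add: "periodic L A \<Longrightarrow> k + L \<in> A \<longleftrightarrow> k \<in> A"
  by (simp add: periodic_def)

lemma periodic_diff: "periodic L A \<Longrightarrow> k - L \<in> A \<longleftrightarrow> k \<in> A"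
  using periodic_add[of L A "k - L"] by simp

lemma periodic_mult:
  assumes "periodic L A"
  shows "k + m * L \<in> A \<longleftrightarrow> k \<in> A"
proof (induction m rule: int_induct[where k = 0])
  case (step1 i)
  then show ?case using periodic_add[OF assms, of "k + i * L"] by (simp add: algebra_simps)
next
  case (step2 i)
  then show ?case using periodic_diff[OF assms, of "k + i * L"] by (simp add: algebra_simps)
qed simp

lemma periodic_mod: "periodic L A \<Longrightarrow> k mod L \<in> A \<longleftrightarrow> k \<in> A"
  using periodic_mult[of L A k "- (k div L)"] by (simp add: minus_div_mult_eq_mod)

lemma periodic_vimage_add: "periodic L A \<Longrightarrow> periodic L {k. k + c \<in> A}"
  unfolding periodic_def by (metis add.assoc add.commute mem_Collect_eq)

text \<open>Any window of length $L$ serves as a system of representatives; each argument below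
  uses the window that starts right after a suitably chosen element of $A$.\<close>

lemma period_card_eq_card_window:
  assumes "periodic L A" "0 < L"
  shows "period_card L A = int (card (A \<inter> {r<..r + L}))"
proof -
  have "inj_on (\<lambda>x. x mod L) {r<..r + L}"
  proof (rule inj_onI)
    fix x y assume xy: "x \<in> {r<..r + L}" "y \<in> {r<..r + L}" "x mod L = y mod L"
    then have "L dvd x - y" by (simp add: mod_eq_dvd_iff)
    moreover have "\<bar>x - y\<bar> < \<bar>L\<bar>" using xy assms(2) by auto
    ultimately show "x = y" using dvd_imp_le_int[of "x - y" L] by force
  qed
  moreover have "(\<lambda>x. x mod L) ` (A \<inter> {r<..r + L}) = A \<inter> {0..<L}"
  proof (intro set_eqI iffI)
    fix y assume "y \<in> (\<lambda>x. x mod L) ` (A \<inter> {r<..r + L})"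
    then show "y \<in> A \<inter> {0..<L}" using periodic_mod[OF assms(1)] assms(2) by auto
  next
    fix y assume y: "y \<in> A \<inter> {0..<L}"
    define x where "x = r + 1 + (y - (r + 1)) mod L"
    have "x mod L = y"
      unfolding x_def using y by (simp add: mod_add_right_eq)
    moreover from this have "x \<in> A" using periodic_mod[OF assms(1), of x] y by simp
    moreover have "x \<in> {r<..r + L}"
      using pos_mod_bound[OF assms(2), of "y - (r + 1)"] pos_mod_sign[OF assms(2), of "y - (r + 1)"]
      unfolding x_def greaterThanAtMost_iff by linarith
    ultimately show "y \<in> (\<lambda>x. x mod L) ` (A \<inter> {r<..r + L})" by blast
  qed
  ultimately show ?thesis
    unfolding period_card_def by (metis card_image inj_on_subset inf_le2)
qed

lemma period_card_vimage_add:
  assumes "periodic L A" "0 < L"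
  shows "period_card L {k. k + c \<in> A} = period_card L A"
proof -
  have "A \<inter> {c - 1<..c - 1 + L} = (\<lambda>k. k + c) ` ({k. k + c \<in> A} \<inter> {0..<L})"
  proof (intro set_eqI iffI)
    fix y assume "y \<in> A \<inter> {c - 1<..c - 1 + L}"
    then show "y \<in> (\<lambda>k. k + c) ` ({k. k + c \<in> A} \<inter> {0..<L})"
      by (intro image_eqI[of _ _ "y - c"]) auto
  qed auto
  then show ?thesis
    using period_card_eq_card_window[OF assms, of "c - 1"] by (simp add: period_card_def card_image)
qed

text \<open>The point $x$ lies in a unique gap between consecutive elements of $A$; the left end
  is strict so that $x$ itself may belong to $A$.\<close>

lemma gap_around:
  assumes "periodic L A" "0 < L" "A \<noteq> {}"
  obtains p q where "p \<in> A" "q \<in> A" "p < x" "x \<le> q" "q \<le> p + L" "\<And>k. p < k \<Longrightarrow> k < q \<Longrightarrow> k \<notin> A"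
proof -
  obtain a where a: "a \<in> A" using assms(3) by blast
  have mem: "a + m * L \<in> A" for m using periodic_mult[OF assms(1)] a by simp
  define S where "S = A \<inter> {x - L..<x}"
  define T where "T = A \<inter> {x..<x + L}"
  define p0 where "p0 = x - 1 - (x - 1 - a) mod L"
  have "p0 = a + ((x - 1 - a) div L) * L"
    unfolding p0_def using div_mult_mod_eq[of "x - 1 - a" L] by linarith
  then have "p0 \<in> A" using mem by simp
  moreover have p0: "x - L \<le> p0" "p0 < x"
    unfolding p0_def using pos_mod_bound[OF assms(2), of "x - 1 - a"]
      pos_mod_sign[OF assms(2), of "x - 1 - a"] by linarith+
  ultimately have S0: "p0 \<in> S" and T0: "p0 + L \<in> T"
    using periodic_add[OF assms(1)] by (auto simp: S_def T_def)
  have fin: "finite S" "finite T" by (auto simp: S_def T_def)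
  have S: "Max S \<in> S" and T: "Min T \<in> T"
    using Max_in[OF fin(1)] Min_in[OF fin(2)] S0 T0 by blast+
  have "p0 \<le> Max S" "Min T \<le> p0 + L"
    using fin S0 T0 by simp_all
  then have "Min T \<le> Max S + L" by linarith
  moreover have "k \<notin> A" if "Max S < k" "k < Min T" for k
  proof
    assume "k \<in> A"
    show False
    proof (cases "k < x")
      case True
      then have "k \<in> S" using \<open>k \<in> A\<close> that S by (auto simp: S_def)
      then show False using Max_ge[OF fin(1)] that by fastforce
    next
      case False
      then have "k \<in> T" using \<open>k \<in> A\<close> that T by (auto simp: T_def)
      then show False using Min_le[OF fin(2)] that by fastforce
    qed
  qed
  ultimately show ?thesis
    using that[of "Max S" "Min T"] S T by (auto simp: S_def T_def)
qed

lemma periodic_mod_index: "periodic (int n) {k. Q (nat (k mod int n))}"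
  by (simp add: periodic_def)

lemma period_card_mod_index:
  "period_card (int n) {k. Q (nat (k mod int n))} = int (card {i. i < n \<and> Q i})"
proof -
  have "{k. Q (nat (k mod int n))} \<inter> {0..<int n} = int ` {i. i < n \<and> Q i}"
  proof (intro set_eqI iffI)
    fix k assume "k \<in> {k. Q (nat (k mod int n))} \<inter> {0..<int n}"
    then show "k \<in> int ` {i. i < n \<and> Q i}" by (intro image_eqI[of _ _ "nat k"]) auto
  qed auto
  then show ?thesis by (simp add: period_card_def card_image)
qed

text \<open>A Cauchy--Davenport bound for an interval summand: the sumset $A + [1, K]$ misses $J$
  and has at least $|A| + K - 1$ elements, namely $A + 1$ and the $K - 1$ elements that the
  interval adds behind the left end of one long gap. Any element of $J$ certifies that such a gap
  exists.\<close>

lemma period_card_window_le: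
  assumes "periodic L A" "periodic L J" "0 < L" "1 \<le> K" "A \<noteq> {}" "J \<noteq> {}"
    and avoid: "\<And>i j. i \<in> A \<Longrightarrow> i < j \<Longrightarrow> j \<le> i + K \<Longrightarrow> j \<notin> J"
  shows "period_card L A + period_card L J + K - 1 \<le> L"
proof -
  obtain x where x: "x \<in> J" using assms(6) by blast
  obtain p q where pq: "p \<in> A" "q \<in> A" "p < x" "x \<le> q" "q \<le> p + L" 
     "\<And>k. p < k \<Longrightarrow> k < q \<Longrightarrow> k \<notin> A"
    using gap_around[OF assms(1,3,5), of x] by blast
  have Kx: "p + K < x" using avoid[OF pq(1) pq(3)] x by linarith
  (* In the period that starts behind p, the sets A + 1, J and the interval Z behind p + 1 are
     pairwise disjoint. *)
  define X where "X = {k. k + (-1) \<in> A} \<inter> {p<..p + L}"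
  define Y where "Y = J \<inter> {p<..p + L}"
  define Z where "Z = {p + 2..p + K}"
  have dA: "period_card L A = int (card X)"
    using period_card_vimage_add[OF assms(1,3), of "-1"]
      period_card_eq_card_window[OF periodic_vimage_add[OF assms(1)] assms(3), of "-1" p]
    unfolding X_def by simp
  have dJ: "period_card L J = int (card Y)"
    unfolding Y_def by (rule period_card_eq_card_window[OF assms(2,3)])
  have fin: "finite X" "finite Y" "finite Z" unfolding X_def Y_def Z_def by auto
  have "y \<notin> Y" if "y \<in> X" for y
    using avoid[of "y - 1" y] that assms(4) unfolding X_def Y_def by auto
  then have XY: "X \<inter> Y = {}" by blast
  have XZ: "X \<inter> Z = {}"
    using pq(4,6) Kx unfolding X_def Z_def by auto
  have YZ: "Y \<inter> Z = {}"
    using avoid[OF pq(1)] unfolding Y_def Z_def by auto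
  have "card X + card Y + card Z = card (X \<union> Y \<union> Z)"
    using XY XZ YZ fin by (simp add: card_Un_disjoint Int_Un_distrib2)
  also have "\<dots> \<le> card {p<..p + L}"
    using Kx pq(4,5) by (intro card_mono) (auto simp: X_def Y_def Z_def)
  finally show ?thesis using dA dJ assms(3,4) by (simp add: Z_def)
qed

text \<open>Each gap of $A$ that contains an element of $J$ is longer than $K$ and contributes $K
  - 1$ elements to $A + [1, K]$ beyond $A + 1$. If $A$ and $J$ nearly fill the cycle, there is no
  room for two such gaps, so all of $J$ sits in a single gap $(p, q]$, at distance more than $K$
  from $p$.\<close>

lemma single_gap:
  assumes "periodic L A" "periodic L J" "0 < L" "1 \<le> K" "A \<noteq> {}" "J \<noteq> {}"
    and avoid: "\<And>i j. i \<in> A \<Longrightarrow> i < j \<Longrightarrow> j \<le> i + K \<Longrightarrow> j \<notin> J"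
    and dense: "L < period_card L A + period_card L J + 2 * K - 2"
  obtains p q where "p \<in> A" "q \<in> A" "p < q" "q - p \<le> L - period_card L A + 1"
    "J \<inter> {p<..p + L} \<subseteq> {p + K<..q}"
proof -
  obtain x where x: "x \<in> J" using assms(6) by blast
  obtain p q where pq: "p \<in> A" "q \<in> A" "p < x" "x \<le> q" "q \<le> p + L" 
     "\<And>k. p < k \<Longrightarrow> k < q \<Longrightarrow> k \<notin> A"
    using gap_around[OF assms(1,3,5), of x] by blast
  have Kx: "p + K < x" using avoid[OF pq(1) pq(3)] x by linarith
  have "p + K < y \<and> y \<le> q" if y: "y \<in> J" "p < y" "y \<le> p + L" for y
  proof
    show "p + K < y" using avoid[OF pq(1) y(2)] y(1) by linarith
    show "y \<le> q"
    proof (rule ccontr)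
      assume yq: "\<not> y \<le> q"
      obtain p' q' where pq': "p' \<in> A" "q' \<in> A" "p' < y" "y \<le> q'" "q' \<le> p' + L" 
         "\<And>k. p' < k \<Longrightarrow> k < q' \<Longrightarrow> k \<notin> A"
        using gap_around[OF assms(1,3,5), of y] by blast
      (* The gap around y is a second long gap, with its own interval Z' disjoint from Z. *)
      have Ky: "p' + K < y" using avoid[OF pq'(1) pq'(3)] y by linarith
      have qp': "q \<le> p'" using pq'(4) pq'(6)[of q] pq(2) yq by linarith
      define X where "X = {k. k + (-1) \<in> A} \<inter> {p<..p + L}"
      define Y where "Y = J \<inter> {p<..p + L}"
      define Z where "Z = {p + 2..p + K}"
      define Z' where "Z' = {p' + 2..p' + K}"
      have dA: "period_card L A = int (card X)"
        using period_card_vimage_add[OF assms(1,3), of "-1"]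
          period_card_eq_card_window[OF periodic_vimage_add[OF assms(1)] assms(3), of "-1" p]
        unfolding X_def by simp
      have dJ: "period_card L J = int (card Y)"
        unfolding Y_def by (rule period_card_eq_card_window[OF assms(2,3)])
      have fin: "finite X" "finite Y" "finite Z" "finite Z'"
        unfolding X_def Y_def Z_def Z'_def by auto
      have "y \<notin> Y" if "y \<in> X" for y
        using avoid[of "y - 1" y] that assms(4) unfolding X_def Y_def by auto
      then have XY: "X \<inter> Y = {}" by blast
      have XZ: "X \<inter> Z = {}" using pq(4,6) Kx unfolding X_def Z_def by auto
      have XZ': "X \<inter> Z' = {}" using pq'(4,6) Ky unfolding X_def Z'_def by auto
      have YZ: "Y \<inter> Z = {}" using avoid[OF pq(1)] unfolding Y_def Z_def by auto
      have YZ': "Y \<inter> Z' = {}" using avoid[OF pq'(1)] unfolding Y_def Z'_def by auto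
      have ZZ': "Z \<inter> Z' = {}" using Kx qp' pq(4) unfolding Z_def Z'_def by auto
      have "card X + card Y + card Z + card Z' = card (X \<union> Y \<union> Z \<union> Z')"
        using XY XZ YZ XZ' YZ' ZZ' fin by (simp add: card_Un_disjoint Int_Un_distrib2)
      also have "\<dots> \<le> card {p<..p + L}"
      proof (intro card_mono)
        have "Z \<subseteq> {p<..p + L}" using Kx pq(4,5) by (auto simp: Z_def)
        moreover have "Z' \<subseteq> {p<..p + L}" using Ky qp' pq(3,4) y(3) by (auto simp: Z'_def)
        ultimately show "X \<union> Y \<union> Z \<union> Z' \<subseteq> {p<..p + L}" by (auto simp: X_def Y_def)
      qed simp
      finally show False using dA dJ dense assms(3,4) by (simp add: Z_def Z'_def)
    qed
  qed
  then have "J \<inter> {p<..p + L} \<subseteq> {p + K<..q}" by auto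
  moreover have "period_card L A \<le> L - (q - p) + 1"
  proof -
    have "A \<inter> {p<..p + L} \<subseteq> {q..p + L}" using pq(6) by force
    then have "card (A \<inter> {p<..p + L}) \<le> card {q..p + L}" by (intro card_mono) auto
    then show ?thesis using period_card_eq_card_window[OF assms(1,3), of p] pq(5) by simp
  qed
  ultimately show ?thesis using that[OF pq(1,2)] pq(3,4) by simp
qed

text \<open>The longer of the two forbidden intervals confines $J$ to a single gap $(p, q]$ of
  $A$, more precisely to a piece of it: the constant in the last hypothesis fits
  \<open>single_gap\<close> because $b + w - 3 < 2 \max(b, w) - 2$. The shorter forbidden
  interval, attached to $p$ or to $q$, cannot lie inside that piece, since this would remove more
  elements than the last hypothesis leaves to spare. Hence it reaches past an end of the piece,
  and what remains for $J$ is contained in an interval of length $t - b$.\<close>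

lemma two_windows:
  assumes "periodic L A" "periodic L J" "0 < L" "A \<noteq> {}" "J \<noteq> {}" "1 \<le> b" "b \<le> t"
    and avoid1: "\<And>i j. i \<in> A \<Longrightarrow> i < j \<Longrightarrow> j \<le> i + b \<Longrightarrow> j \<notin> J"
    and avoid2: "\<And>i j. i \<in> A \<Longrightarrow> i + t < j \<Longrightarrow> j \<le> i + t + w \<Longrightarrow> j \<notin> J"
    and dense: "L \<le> period_card L A + period_card L J + b + w - 3"
  shows "period_card L J \<le> t - b"
proof (cases "w \<le> b")
  case True
  have "L < period_card L A + period_card L J + 2 * b - 2" using dense True by linarith
  then obtain p q where pq: "p \<in> A" "q \<in> A" "p < q" "q - p \<le> L - period_card L A + 1"
    "J \<inter> {p<..p + L} \<subseteq> {p + b<..q}"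
    by (rule single_gap[OF assms(1-3,6,4,5), rotated]) (use avoid1 in blast)+
  define Y where "Y = J \<inter> {p<..p + L}"
  have dJ: "period_card L J = int (card Y)"
    unfolding Y_def by (rule period_card_eq_card_window[OF assms(2,3)])
  have Y: "p + b < j \<and> j \<le> q \<and> j \<notin> {p + t<..p + t + w}" if "j \<in> Y" for j
    using pq(5) avoid2[OF pq(1)] that by (auto simp: Y_def)
  have fin: "finite Y" by (simp add: Y_def)
  show ?thesis
  proof (cases "p + t + w \<le> q")
    case True
    have "card Y + card {p + t<..p + t + w} = card (Y \<union> {p + t<..p + t + w})"
      using Y fin by (intro card_Un_disjoint[symmetric]) auto
    also have "\<dots> \<le> card {p + b<..q}"
      using Y True assms(7) by (intro card_mono) force+
    finally show ?thesis using dJ dense pq(4) assms(6,7) by simp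
  next
    case False
    have "Y \<subseteq> {p + b<..p + t}"
      using Y False by force
    then have "card Y \<le> card {p + b<..p + t}"
      by (intro card_mono) auto
    then show ?thesis using dJ assms(7) by simp
  qed
next
  case False
  (* Shifting J by t turns the second window into an interval that starts at distance 1. *)
  define J' where "J' = {k. k + t \<in> J}"
  have per: "periodic L J'" and den: "period_card L J' = period_card L J"
    using periodic_vimage_add[OF assms(2)] period_card_vimage_add[OF assms(2,3)]
    unfolding J'_def by auto
  obtain j0 where "j0 \<in> J" using assms(5) by blast
  then have "j0 - t \<in> J'" by (simp add: J'_def)
  then have ne: "J' \<noteq> {}" by blast
  have av: "j \<notin> J'" if "i \<in> A" "i < j" "j \<le> i + w" for i j
    using avoid2[OF that(1), of "j + t"] that by (simp add: J'_def)
  have w: "1 \<le> w" using False assms(6) by linarith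
  have "L < period_card L A + period_card L J' + 2 * w - 2" using dense False den by linarith
  then obtain p q where pq: "p \<in> A" "q \<in> A" "p < q" "q - p \<le> L - period_card L A + 1"
    "J' \<inter> {p<..p + L} \<subseteq> {p + w<..q}"
    by (rule single_gap[OF assms(1) per assms(3) w assms(4) ne, rotated]) (use av in blast)+
  define Y where "Y = J' \<inter> {p<..p + L}"
  have dJ: "period_card L J = int (card Y)"
    unfolding Y_def den[symmetric] by (rule period_card_eq_card_window[OF per assms(3)])
  have out: "j \<notin> {q - t<..q - t + b}" if "j \<in> J'" for j
    using avoid1[OF pq(2), of "j + t"] that by (auto simp: J'_def)
  have Y: "p + w < j \<and> j \<le> q \<and> j \<notin> {q - t<..q - t + b}" if "j \<in> Y" for j
    using pq(5) out[of j] that unfolding Y_def by auto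
  have fin: "finite Y" by (simp add: Y_def)
  show ?thesis
  proof (cases "p + w \<le> q - t")
    case True
    have "card Y + card {q - t<..q - t + b} = card (Y \<union> {q - t<..q - t + b})"
      using Y fin by (intro card_Un_disjoint[symmetric]) auto
    also have "\<dots> \<le> card {p + w<..q}"
      using Y True assms(7) by (intro card_mono) force+
    finally show ?thesis using dJ dense pq(4) assms(6,7) True by simp
  next
    case False
    have "Y \<subseteq> {q - t + b<..q}"
      using Y False by force
    then have "card Y \<le> card {q - t + b<..q}"
      by (intro card_mono) auto
    then show ?thesis using dJ assms(7) by simp
  qed
qed

section \<open>Directed paths, chords and rotations\<close>

text \<open>The vertex set is a parameter because for $s = t = 0$ no arc forces the single vertex
  of the path to lie in $V$.\<close>

definition two_block_path :: "'a set \<Rightarrow> ('a \<Rightarrow> 'a \<Rightarrow> bool) \<Rightarrow> nat \<Rightarrow> nat \<Rightarrow> bool" where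
  "two_block_path V E s t \<longleftrightarrow> (\<exists>u. inj_on u {0..s + t} \<and> u ` {0..s + t} \<subseteq> V \<and>
     (\<forall>i<s. E (u i) (u (Suc i))) \<and>
     (\<forall>i. s \<le> i \<and> i < s + t \<longrightarrow> E (u (Suc i)) (u i)))"

lemma two_block_path_commute:
  assumes "two_block_path V E s t"
  shows "two_block_path V E t s"
proof -
  obtain u where u: "inj_on u {0..s + t}" "u ` {0..s + t} \<subseteq> V" "\<forall>i<s. E (u i) (u (Suc i))"
    "\<forall>i. s \<le> i \<and> i < s + t \<longrightarrow> E (u (Suc i)) (u i)"
    using assms unfolding two_block_path_def by blast
  have "inj_on (\<lambda>i. u (s + t - i)) {0..t + s}"
    by (rule inj_onI) (drule inj_onD[OF u(1)], auto)
  moreover have "(\<lambda>i. u (s + t - i)) ` {0..t + s} \<subseteq> V"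
    using u(2) by auto
  moreover have "E (u (s + t - i)) (u (s + t - Suc i))" if "i < t" for i
    using u(4)[rule_format, of "s + t - Suc i"] that by (simp add: Suc_diff_Suc)
  moreover have "E (u (s + t - Suc i)) (u (s + t - i))" if "t \<le> i" "i < t + s" for i
    using u(3)[rule_format, of "s + t - Suc i"] that by (simp add: Suc_diff_Suc)
  ultimately show ?thesis
    unfolding two_block_path_def by (intro exI[of _ "\<lambda>i. u (s + t - i)"]) blast
qed

lemma two_block_path_mono:
  assumes "two_block_path V E s t" "t' \<le> t"
  shows "two_block_path V E s t'"
proof -
  obtain u where u: "inj_on u {0..s + t}" "u ` {0..s + t} \<subseteq> V" "\<forall>i<s. E (u i) (u (Suc i))"
    "\<forall>i. s \<le> i \<and> i < s + t \<longrightarrow> E (u (Suc i)) (u i)"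
    using assms unfolding two_block_path_def by blast
  have "inj_on u {0..s + t'}" using u(1) assms(2) by (auto intro: inj_on_subset)
  then show ?thesis
    unfolding two_block_path_def using u assms(2) by (intro exI[of _ u]) (auto simp: image_subset_iff)
qed

definition directed_path :: "'a set \<Rightarrow> ('a \<Rightarrow> 'a \<Rightarrow> bool) \<Rightarrow> 'a list \<Rightarrow> bool" where
  "directed_path V E xs \<longleftrightarrow> xs \<noteq> [] \<and> distinct xs \<and> successively E xs \<and> set xs \<subseteq> V"

text \<open>A chord from the last vertex back to $q_x$ gives $q_x$ a second way in: one leg of the
  copy runs along the path up to $q_x$, the other one is the final segment of the path followed by
  the chord. Both legs may be shortened at their starts.\<close>

lemma two_block_path_of_chord:
  assumes "directed_path V E xs" "E (last xs) (xs ! x)" "s \<le> x" "x + t < length xs"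
  shows "two_block_path V E s t"
proof -
  let ?n = "length xs"
  have d: "distinct xs" and ne: "xs \<noteq> []" and succ: "\<And>i. Suc i < ?n \<Longrightarrow> E (xs ! i) (xs ! Suc i)"
    using assms(1) by (auto simp: directed_path_def successively_nth)
  (* u_0, ..., u_s are q_(x-s), ..., q_x; then the copy continues with the last vertex of the path
     and walks backwards. *)
  define g where "g i = (if i \<le> s then x - s + i else ?n + s - i)" for i
  have lt: "g i < ?n" if "i \<le> s + t" for i
    using that assms(3,4) by (auto simp: g_def)
  have inj: "inj_on (\<lambda>i. xs ! g i) {0..s + t}"
  proof (rule inj_onI)
    fix i j assume ij: "i \<in> {0..s + t}" "j \<in> {0..s + t}" "xs ! g i = xs ! g j"
    then have "g i = g j" using d lt by (simp add: nth_eq_iff_index_eq)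
    then show "i = j" using ij(1,2) assms(3,4) by (auto simp: g_def split: if_splits)
  qed
  have sub: "(\<lambda>i. xs ! g i) ` {0..s + t} \<subseteq> V"
    using assms(1) lt by (auto simp: directed_path_def subset_iff)
  have fwd: "E (xs ! g i) (xs ! g (Suc i))" if "i < s" for i
    using succ[of "g i"] that assms(3,4) by (simp add: g_def)
  have bwd: "E (xs ! g (Suc i)) (xs ! g i)" if "s \<le> i" "i < s + t" for i
  proof (cases "i = s")
    case True
    then have "g (Suc i) = ?n - 1" "g i = x" using assms(3) by (auto simp: g_def)
    then show ?thesis using assms(2) ne by (simp add: last_conv_nth)
  next
    case False
    then have "g i = Suc (g (Suc i))" "g i < ?n" using that assms(4) lt[of i] by (auto simp: g_def)
    then show ?thesis using succ[of "g (Suc i)"] by simp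
  qed
  show ?thesis
    unfolding two_block_path_def using inj sub fwd bwd by (intro exI[of _ "\<lambda>i. xs ! g i"]) blast
qed

lemma last_rotate_Suc: "i < length xs \<Longrightarrow> last (rotate (Suc i) xs) = xs ! i"
proof -
  assume "i < length xs"
  moreover from this have "Suc i + (length xs - 1) = i + length xs" by simp
  then have "(Suc i + (length xs - 1)) mod length xs = i"
    using \<open>i < length xs\<close> by (simp only: mod_add_self2 mod_less)
  ultimately show ?thesis
    by (subst last_conv_nth) (auto simp: nth_rotate simp del: rotate_Suc)
qed

text \<open>The rotation behind the whole argument. When the path $stem\,@\,cyc$ closes up to a
  cycle on $cyc$, the cycle may be traversed first, from the successor of position $i$ round to
  position $i$, provided that an arc leads from there to the start of the stem. The new path ends
  where the stem ends.\<close>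

lemma directed_path_rotate_append:
  assumes "directed_path V E (stem @ cyc)" "i < length cyc" "E (last cyc) (hd cyc)"
    "stem \<noteq> [] \<Longrightarrow> E (cyc ! i) (hd stem)"
  shows "directed_path V E (rotate (Suc i) cyc @ stem)"
proof -
  let ?L = "length cyc"
  have ne: "cyc \<noteq> []" using assms(2) by auto
  have sc: "successively E cyc" "successively E stem" "distinct (stem @ cyc)"
    "set stem \<subseteq> V" "set cyc \<subseteq> V"
    using assms(1) by (auto simp: directed_path_def successively_append_iff)
  have step: "E (cyc ! k) (cyc ! (Suc k mod ?L))" if "k < ?L" for k
  proof (cases "Suc k = ?L")
    case True
    then have "k = ?L - 1" by simp
    with True assms(3) ne show ?thesis by (simp add: last_conv_nth hd_conv_nth)
  next
    case False
    then show ?thesis using successively_nth[OF sc(1), of k] that by simp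
  qed
  have "successively E (rotate (Suc i) cyc)"
    unfolding successively_conv_nth
  proof (intro allI impI)
    fix k assume k: "Suc k < length (rotate (Suc i) cyc)"
    have "E (cyc ! ((Suc i + k) mod ?L)) (cyc ! (Suc ((Suc i + k) mod ?L) mod ?L))"
      by (rule step) (use ne in simp)
    moreover have "Suc ((Suc i + k) mod ?L) mod ?L = (Suc i + Suc k) mod ?L"
      by (simp add: mod_Suc_eq)
    ultimately show "E (rotate (Suc i) cyc ! k) (rotate (Suc i) cyc ! Suc k)"
      using k by (simp add: nth_rotate del: rotate_Suc)
  qed
  then show ?thesis
    using assms(2,4) sc ne
    by (auto simp: directed_path_def successively_append_iff last_rotate_Suc simp del: rotate_Suc)
qed

section \<open>Oriented relations of large minimum semi-degree\<close>

text \<open>In the absence of parallel arcs the adjacency relation carries all the information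
  that matters here, so arcs need no identity of their own.\<close>

locale oriented_min_degree =
  fixes V :: "'a set" and E :: "'a \<Rightarrow> 'a \<Rightarrow> bool" and d :: nat
  assumes finite_V: "finite V" and nonempty_V: "V \<noteq> {}"
    and E_in_V: "E u v \<Longrightarrow> u \<in> V \<and> v \<in> V"
    and asym: "E u v \<Longrightarrow> \<not> E v u"
    and d_pos: "1 \<le> d"
    and outdeg: "v \<in> V \<Longrightarrow> d \<le> card {u. E v u}"
    and indeg: "v \<in> V \<Longrightarrow> d \<le> card {u. E u v}"
begin

lemma irrefl: "\<not> E v v"
  using asym by blast

definition longest_path :: "'a list \<Rightarrow> bool" where
  "longest_path xs \<longleftrightarrow> directed_path V E xs \<and>
     (\<forall>ys. directed_path V E ys \<longrightarrow> length ys \<le> length xs)"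

lemma longest_path_exists: "\<exists>xs. longest_path xs"
proof -
  obtain v where v: "v \<in> V" using nonempty_V by blast
  have "\<exists>xs. directed_path V E xs \<and> (\<forall>ys. directed_path V E ys \<longrightarrow> length ys \<le> length xs)"
  proof (rule ex_has_greatest_nat[where f = length and k = "[v]" and b = "Suc (card V)"])
    show "directed_path V E [v]" using v by (simp add: directed_path_def)
    show "\<forall>ys. directed_path V E ys \<longrightarrow> length ys < Suc (card V)"
      using finite_V by (auto simp: directed_path_def less_Suc_eq_le) (metis card_mono distinct_card)
  qed
  then show ?thesis unfolding longest_path_def by blast
qed

lemma longest_path_same_vertices:
  assumes "longest_path xs" "directed_path V E ys" "set ys = set xs"
  shows "longest_path ys"
proof -
  have "length ys = length xs"
    using assms by (metis distinct_card directed_path_def longest_path_def)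
  then show ?thesis using assms unfolding longest_path_def by simp
qed

lemma out_neighbours_last:
  assumes "longest_path xs" "E (last xs) v"
  shows "v \<in> set xs"
proof (rule ccontr)
  assume "v \<notin> set xs"
  then have "directed_path V E (xs @ [v])"
    using assms E_in_V by (auto simp: longest_path_def directed_path_def successively_append_iff)
  then show False using assms(1) unfolding longest_path_def by fastforce
qed

lemma in_neighbours_hd:
  assumes "longest_path xs" "E v (hd xs)"
  shows "v \<in> set xs"
proof (rule ccontr)
  assume "v \<notin> set xs"
  then have "directed_path V E (v # xs)"
    using assms E_in_V by (auto simp: longest_path_def directed_path_def successively_Cons)
  then show False using assms(1) unfolding longest_path_def by fastforce
qed

lemma card_positions:
  assumes "{u. Q u} \<subseteq> set xs"
  shows "card {u. Q u} \<le> card {i. i < length xs \<and> Q (xs ! i)}"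
proof -
  have "{u. Q u} \<subseteq> (!) xs ` {i. i < length xs \<and> Q (xs ! i)}"
  proof
    fix u assume u: "u \<in> {u. Q u}"
    then obtain i where "i < length xs" "u = xs ! i"
      using assms by (metis in_set_conv_nth subsetD)
    then show "u \<in> (!) xs ` {i. i < length xs \<and> Q (xs ! i)}" using u by auto
  qed
  then have "card {u. Q u} \<le> card ((!) xs ` {i. i < length xs \<and> Q (xs ! i)})"
    by (intro card_mono) auto
  also have "\<dots> \<le> card {i. i < length xs \<and> Q (xs ! i)}"
    by (intro card_image_le) auto
  finally show ?thesis .
qed

text \<open>If a longest path closes up to a cycle of length $n$, every vertex of the cycle is
  both the start and the end of a longest path, so all its neighbours lie on the cycle. Measure
  positions from the vertex $v$. The chord criterion, applied to the rotations that end in $v$ and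
  in $v$'s in-neighbour, forbids certain positions both for out- and for in-neighbours. As the
  relation is oriented, the two neighbourhoods occupy at least $2d$ of the $n - 1$ positions,
  which is more than the forbidden set $B$ leaves.\<close>

lemma hamiltonian_cycle_two_block:
  assumes "longest_path xs" "E (last xs) (hd xs)" "s + t + 1 = 2 * d" "t < s"
  shows "two_block_path V E s t"
proof (rule ccontr)
  assume no: "\<not> two_block_path V E s t"
  then have no': "\<not> two_block_path V E t s" using two_block_path_commute by blast
  let ?n = "length xs"
  have path: "directed_path V E xs" and ne: "xs \<noteq> []" and sub: "set xs \<subseteq> V"
    using assms(1) by (auto simp: longest_path_def directed_path_def)
  define v where "v = xs ! 0"
  have hd: "hd xs = v" using ne by (simp add: v_def hd_conv_nth)
  have vV: "v \<in> V" using ne sub by (auto simp: v_def)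
  have rot: "directed_path V E (rotate (Suc i) xs)" if "i < ?n" for i
    using directed_path_rotate_append[of V E "[]" xs i] path assms(2) that by simp
  define Out where "Out = {i. i < ?n \<and> E v (xs ! i)}"
  define In where "In = {i. i < ?n \<and> E (xs ! i) v}"
  have "longest_path (rotate (Suc 0) xs)"
    using longest_path_same_vertices[OF assms(1)] rot[of 0] ne by simp
  then have "{u. E v u} \<subseteq> set xs"
    using out_neighbours_last[of "rotate (Suc 0) xs"] last_rotate_Suc[of 0 xs] ne
    unfolding v_def by auto
  then have Out: "d \<le> card Out"
    unfolding Out_def using outdeg[OF vV] card_positions[of "E v" xs] by linarith
  have "{u. E u v} \<subseteq> set xs" using in_neighbours_hd[OF assms(1)] hd by blast
  then have In: "d \<le> card In"
    unfolding In_def using indeg[OF vV] card_positions[of "\<lambda>u. E u v" xs] by linarith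
  have OutI: "1 \<le> i \<and> i < ?n \<and> \<not> (s < i \<and> i + t < ?n) \<and> \<not> (t < i \<and> i + s < ?n)" if "i \<in> Out" for i
  proof -
    have i: "i < ?n" "E v (xs ! i)" using that by (auto simp: Out_def)
    then have i1: "1 \<le> i" using irrefl by (cases "i = 0") (auto simp: v_def)
    have "rotate (Suc 0) xs ! (i - 1) = xs ! i"
      using i i1 by (simp add: nth_rotate del: rotate_Suc)
    then have "E (last (rotate (Suc 0) xs)) (rotate (Suc 0) xs ! (i - 1))"
      using i last_rotate_Suc[of 0 xs] ne unfolding v_def by simp
    then show ?thesis
      using two_block_path_of_chord[OF rot[of 0], of "i - 1"] ne i i1 no no' by fastforce
  qed
  have InI: "1 \<le> i \<and> i < ?n \<and> \<not> (s < i \<and> i + t < ?n) \<and> \<not> (t < i \<and> i + s < ?n)" if "i \<in> In" for i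
  proof -
    have i: "i < ?n" "E (xs ! i) v" using that by (auto simp: In_def)
    then have i1: "1 \<le> i" using irrefl by (cases "i = 0") (auto simp: v_def)
    have "rotate (Suc i) xs ! (?n - Suc i) = xs ! 0"
    proof -
      have "(Suc i + (?n - Suc i)) mod ?n = 0" using i by (simp del: add_Suc)
      then show ?thesis using i by (simp add: nth_rotate del: rotate_Suc add_Suc)
    qed
    then have "E (last (rotate (Suc i) xs)) (rotate (Suc i) xs ! (?n - Suc i))"
      using i last_rotate_Suc[of i xs] ne unfolding v_def by simp
    then show ?thesis
      using two_block_path_of_chord[OF rot[OF i(1)], of "?n - Suc i"] i i1 no no'
      by (fastforce simp del: rotate_Suc)
  qed
  have fin: "finite Out" "finite In" by (auto simp: Out_def In_def)
  have "Out \<inter> In = {}" using asym by (auto simp: Out_def In_def)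
  then have cOI: "2 * d \<le> card (Out \<union> In)"
    using Out In fin by (simp add: card_Un_disjoint)
  define B where "B = {t<..<?n - s} \<union> {s<..<?n - t}"
  have OI: "i \<in> {1..<?n} \<and> i \<notin> B" if "i \<in> Out \<union> In" for i
    using that OutI[of i] InI[of i] by (auto simp: B_def)
  have "card (Out \<union> In) + card B = card (Out \<union> In \<union> B)"
    using fin OI by (intro card_Un_disjoint[symmetric]) (auto simp: B_def)
  also have "\<dots> \<le> card {1..<?n}"
    using OI by (intro card_mono) (auto simp: B_def)
  finally have cB: "2 * d + card B \<le> ?n - 1" using cOI by simp
  (* The two intervals of B either merge into one or are disjoint. *)
  show False
  proof (cases "s + s < ?n")
    case True
    then have "{t<..<?n - t} \<subseteq> B" using assms(4) by (auto simp: B_def)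
    then have "card {t<..<?n - t} \<le> card B" by (intro card_mono) (auto simp: B_def)
    then show False using cB assms(3,4) True by simp
  next
    case False
    then have "card B = card {t<..<?n - s} + card {s<..<?n - t}"
      unfolding B_def by (intro card_Un_disjoint) auto
    then show False using cB assms(3,4) False by simp
  qed
qed

end

context oriented_min_degree begin

text \<open>Among all longest paths and all back arcs from their last vertices, take a path $P$
  and an arc that reaches back as far as possible, to position $b$; let $n$ be the number of
  vertices of $P$. If $b = 0$, the path closes up to a Hamiltonian cycle of its vertex set.
  Otherwise split $P$ into the stem $z, \dots, y$ of $b$ vertices and the cycle formed by the
  other $L = n - b$ vertices. Every in-neighbour $c_i$ of $z$ on the cycle yields a rotated
  longest path that ends in $y$. Therefore an out-neighbour of $y$ on the cycle cannot be at
  position $f$ of such a path if $f < b$, by the choice of $b$, or if $t \le f < n - s$, by the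
  chord criterion. Writing $A$ for the positions of the in-neighbours of $z$ on the cycle and $J$
  for those of the out-neighbours of $y$, this says that $J$ avoids $A + 1 + f$ for these $f$,
  whereas both sets have at least $d - b + 1$ elements since the stem holds at most $b - 1$
  neighbours. If $b < t$, the lemma on two windows bounds $|J|$ by $t - b$, which is too small. If
  $b \ge t$, the chord criterion for the arc to position $b$ itself gives $L \le s$. The second
  forbidden interval $s \le f < n - t$ then lies in the stem of the rotated paths; it moves
  out-neighbours of $y$ from the stem to the cycle and makes $J$ so large that the single window
  of length $b$ suffices.\<close>

theorem two_block_path_exact:
  assumes st: "s + t + 1 = 2 * d" "t < s"
  shows "two_block_path V E s t"
proof (rule ccontr)
  assume no: "\<not> two_block_path V E s t"
  then have no': "\<not> two_block_path V E t s" using two_block_path_commute by blast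
  have chord: "\<not> (s \<le> x \<and> x + t < length xs) \<and> \<not> (t \<le> x \<and> x + s < length xs)"
    if "longest_path xs" "E (last xs) (xs ! x)" for xs x
    using two_block_path_of_chord[of V E xs x s t] two_block_path_of_chord[of V E xs x t s] that no no'
    unfolding longest_path_def by blast
  define P where "P b \<longleftrightarrow> (\<exists>xs. longest_path xs \<and> b < length xs \<and> E (last xs) (xs ! b))" for b
  obtain zs where zs: "longest_path zs" using longest_path_exists by blast
  then have "last zs \<in> V" unfolding longest_path_def directed_path_def by (meson last_in_set subsetD)
  then have "card {u. E (last zs) u} \<noteq> 0" using outdeg d_pos by fastforce
  then obtain u where u: "E (last zs) u" by fastforce
  have "u \<in> set zs" using out_neighbours_last[OF zs u] .
  then obtain x where "x < length zs" "u = zs ! x" by (metis in_set_conv_nth)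
  then have "P x" using zs u unfolding P_def by blast
  define b where "b = (LEAST b. P b)"
  have Pb: "P b" unfolding b_def using \<open>P x\<close> by (rule LeastI)
  have b_least: "b \<le> x" if "P x" for x unfolding b_def using that by (rule Least_le)
  obtain xs where xs: "longest_path xs" "b < length xs" "E (last xs) (xs ! b)"
    using Pb unfolding P_def by blast
  have path: "directed_path V E xs" and ne: "xs \<noteq> []" and sub: "set xs \<subseteq> V"
    using xs(1) by (auto simp: longest_path_def directed_path_def)
  have b0: "0 < b"
  proof (rule ccontr)
    assume "\<not> 0 < b"
    then have "E (last xs) (hd xs)" using xs ne by (simp add: hd_conv_nth)
    then show False using hamiltonian_cycle_two_block[OF xs(1) _ st] no by blast
  qed
  define stem where "stem = take b xs"
  define cyc where "cyc = drop b xs"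
  define L where "L = length cyc"
  let ?n = "length xs"
  have sc: "stem @ cyc = xs" by (simp add: stem_def cyc_def)
  have ls: "length stem = b" and nL: "?n = b + L" and L0: "0 < L" and sne: "stem \<noteq> []"
    using xs(2) b0 by (auto simp: stem_def cyc_def L_def)
  define y where "y = last stem"
  define z where "z = hd stem"
  have z: "z = hd xs" "z \<in> V" and y: "y \<in> V"
    using sne sc sub unfolding z_def y_def by (auto simp flip: sc)
  define B where "B = {x. x < ?n \<and> E (last xs) (xs ! x)}"
  have "last xs \<in> V" using ne sub by (meson last_in_set subsetD)
  then have dB: "d \<le> card B"
    unfolding B_def using outdeg[of "last xs"] card_positions[of "E (last xs)" xs]
      out_neighbours_last[OF xs(1)] by fastforce
  have bB: "b \<le> x" if "x \<in> B" for x
    using b_least[of x] that xs(1) unfolding B_def P_def by blast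
  have "B \<subseteq> {b..<s} \<union> {?n - t..<?n}"
  proof
    fix x assume x: "x \<in> B"
    then show "x \<in> {b..<s} \<union> {?n - t..<?n}"
      using bB[OF x] chord[OF xs(1), of x] unfolding B_def by auto
  qed
  (* At most t out-neighbours of the last vertex are among the last t vertices; the chord criterion
     places all the others before position s. *)
  then have "card B \<le> card ({b..<s} \<union> {?n - t..<?n})" by (intro card_mono) auto
  also have "\<dots> \<le> card {b..<s} + card {?n - t..<?n}" by (rule card_Un_le)
  finally have bd: "b < d" using dB st by simp
  have "B \<subseteq> {b..<?n}" using bB unfolding B_def by auto
  then have "card B \<le> card {b..<?n}" by (intro card_mono) auto
  then have bL: "b < L" using dB bd nL by simp

  define a where "a = card {i. i < L \<and> E (cyc ! i) z}"
  define j where "j = card {i. i < L \<and> E y (cyc ! i)}"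
  define j0 where "j0 = card {i. i < b \<and> E y (stem ! i)}"
  (* Neighbours are counted separately on the stem and on the cycle. *)
  have split: "card {i. i < ?n \<and> Q (xs ! i)} \<le>
      card {i. i < b \<and> Q (stem ! i)} + card {i. i < L \<and> Q (cyc ! i)}" for Q
  proof -
    have "{i. i < ?n \<and> Q (xs ! i)} \<subseteq>
        {i. i < b \<and> Q (stem ! i)} \<union> (+) b ` {i. i < L \<and> Q (cyc ! i)}"
    proof
      fix i assume i: "i \<in> {i. i < ?n \<and> Q (xs ! i)}"
      show "i \<in> {i. i < b \<and> Q (stem ! i)} \<union> (+) b ` {i. i < L \<and> Q (cyc ! i)}"
      proof (cases "i < b")
        case True
        then show ?thesis using i by (simp add: stem_def)
      next
        case False
        then have "i - b \<in> {i. i < L \<and> Q (cyc ! i)}" "i = b + (i - b)"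
          using i nL by (auto simp: cyc_def)
        then show ?thesis by blast
      qed
    qed
    then have "card {i. i < ?n \<and> Q (xs ! i)} \<le>
        card ({i. i < b \<and> Q (stem ! i)} \<union> (+) b ` {i. i < L \<and> Q (cyc ! i)})"
      by (intro card_mono) auto
    also have "\<dots> \<le> card {i. i < b \<and> Q (stem ! i)} + card ((+) b ` {i. i < L \<and> Q (cyc ! i)})"
      by (rule card_Un_le)
    finally show ?thesis by (simp add: card_image)
  qed
  have a: "d \<le> a + (b - 1)"
  proof -
    have "d \<le> card {i. i < ?n \<and> E (xs ! i) z}"
      using indeg[OF z(2)] card_positions[of "\<lambda>u. E u z" xs] in_neighbours_hd[OF xs(1)] z(1)
      by fastforce
    also have "\<dots> \<le> card {i. i < b \<and> E (stem ! i) z} + a"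
      unfolding a_def by (rule split)
    also have "card {i. i < b \<and> E (stem ! i) z} \<le> card {1..<b}"
    proof (intro card_mono subsetI)
      fix i assume i: "i \<in> {i. i < b \<and> E (stem ! i) z}"
      have "z = stem ! 0" using sne by (simp add: z_def hd_conv_nth)
      then have "i \<noteq> 0" using i irrefl[of z] by (intro notI) simp
      then show "i \<in> {1..<b}" using i by simp
    qed simp
    finally show ?thesis by simp
  qed
  define Q where "Q i = rotate (Suc i) cyc @ stem" for i
  have lQ: "length (Q i) = ?n" for i using nL ls by (simp add: Q_def L_def del: rotate_Suc)
  have longest_Q: "longest_path (Q i)" if "i < L" "E (cyc ! i) z" for i
  proof (rule longest_path_same_vertices[OF xs(1)])
    have "E (last cyc) (hd cyc)"
      using xs(2,3) by (simp add: cyc_def hd_drop_conv_nth)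
    then show "directed_path V E (Q i)"
      unfolding Q_def using path that sc
      by (intro directed_path_rotate_append) (auto simp: L_def z_def)
    show "set (Q i) = set xs" unfolding Q_def by (auto simp flip: sc)
  qed
  have last_Q: "last (Q i) = y" for i using sne by (simp add: Q_def y_def)
  have Q_out: "b \<le> f \<and> \<not> (s \<le> f \<and> f + t < ?n) \<and> \<not> (t \<le> f \<and> f + s < ?n)"
    if "i < L" "E (cyc ! i) z" "f < ?n" "E y (Q i ! f)" for i f
  proof -
    have "P f" unfolding P_def using longest_Q[OF that(1,2)] that(3,4) last_Q lQ by metis
    then show ?thesis
      using b_least chord[OF longest_Q[OF that(1,2)], of f] that(4) last_Q lQ by simp
  qed
  have "a \<noteq> 0" using a bd b0 by linarith
  then obtain i0 where i0: "i0 < L" "E (cyc ! i0) z"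
    unfolding a_def by (metis (mono_tags, lifting) card.empty empty_Collect_eq)
  have jj: "d \<le> j0 + j"
  proof -
    have "{u. E y u} \<subseteq> set xs"
      using out_neighbours_last[OF longest_Q[OF i0]] last_Q by (auto simp: Q_def simp flip: sc)
    then have "d \<le> card {i. i < ?n \<and> E y (xs ! i)}"
      using outdeg[OF y] card_positions[of "E y" xs] by linarith
    also have "\<dots> \<le> j0 + j" unfolding j_def j0_def by (rule split)
    finally show ?thesis .
  qed
  have j0: "j0 \<le> b - 1"
  proof -
    have "j0 \<le> card {..<b - 1}"
      unfolding j0_def
    proof (intro card_mono subsetI)
      fix i assume i: "i \<in> {i. i < b \<and> E y (stem ! i)}"
      have "y = stem ! (b - 1)" using sne ls by (simp add: y_def last_conv_nth)
      then have "i \<noteq> b - 1" using i irrefl[of y] by (intro notI) simp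
      then show "i \<in> {..<b - 1}" using i by auto
    qed simp
    then show ?thesis by simp
  qed

  (* From here on the cycle is indexed by the integers modulo L. *)
  define A where "A = {k. E (cyc ! nat (k mod int L)) z}"
  define J where "J = {k. E y (cyc ! nat (k mod int L))}"
  have per: "periodic (int L) A" "periodic (int L) J"
    unfolding A_def J_def by (rule periodic_mod_index)+
  have den: "period_card (int L) A = int a" "period_card (int L) J = int j"
    unfolding A_def J_def a_def j_def
    using period_card_mod_index[of L "\<lambda>i. E (cyc ! i) z"]
      period_card_mod_index[of L "\<lambda>i. E y (cyc ! i)"] by auto
  have "j \<noteq> 0" using jj j0 bd b0 by linarith
  then have ne: "A \<noteq> {}" "J \<noteq> {}"
    using den \<open>a \<noteq> 0\<close> by (auto simp: period_card_def)
  have AJ: "b \<le> f \<and> \<not> (s \<le> f \<and> f + t < ?n) \<and> \<not> (t \<le> f \<and> f + s < ?n)"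
    if k: "k \<in> A" "k + 1 + int f \<in> J" and f: "f < L" for k f
  proof -
    define i where "i = nat (k mod int L)"
    have i: "i < L" "E (cyc ! i) z" and ik: "int i = k mod int L"
      using k(1) L0 by (auto simp: i_def A_def nat_less_iff)
    have "int ((Suc i + f) mod L) = (k mod int L + (1 + int f)) mod int L"
      using ik by (simp add: zmod_int ac_simps)
    also have "\<dots> = (k + 1 + int f) mod int L"
      by (simp add: mod_add_left_eq add.assoc)
    finally have "int ((Suc i + f) mod L) = (k + 1 + int f) mod int L" .
    then have "nat ((k + 1 + int f) mod int L) = (Suc i + f) mod L" by linarith
    then have "E y (Q i ! f)"
      using k(2) f by (simp add: J_def Q_def nth_append nth_rotate L_def del: rotate_Suc)
    then show ?thesis using Q_out[OF i, of f] f nL by simp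
  qed
  have avoid1: "m \<notin> J" if km: "k \<in> A" "k < m" "m \<le> k + int b" for k m
  proof -
    define f where "f = nat (m - k - 1)"
    have f: "m = k + 1 + int f" using km(2) by (simp add: f_def)
    then have "f < b" using km(3) by linarith
    then show ?thesis using AJ[OF km(1), of f] f bL by force
  qed

  (* The number of positions f with t <= f < n - s, possibly negative. *)
  define w where "w = int ?n - int s - int t"
  show False
  proof (cases "b < t")
    case True
    have avoid2: "m \<notin> J" if km: "k \<in> A" "k + int t < m" "m \<le> k + int t + w" for k m
    proof -
      define f where "f = nat (m - k - 1)"
      have f: "m = k + 1 + int f" using km(2) by (simp add: f_def)
      then have "t \<le> f" "f + s < ?n" using km(2,3) unfolding w_def by linarith+
      moreover from this have "f < L" using True st nL by linarith
      ultimately show ?thesis using AJ[OF km(1), of f] f by blast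
    qed
    have "period_card (int L) J \<le> int t - int b"
    proof (rule two_windows[OF per _ ne _ _ avoid1 avoid2])
      show "int L \<le> period_card (int L) A + period_card (int L) J + int b + w - 3"
        unfolding den w_def using a jj j0 st nL b0 by linarith
    qed (use L0 b0 True in auto)
    then show False unfolding den using jj j0 st True by linarith
  next
    case False
    have bs: "?n \<le> b + s" using chord[OF xs(1,3)] False by auto
    (* Positions f >= L of the rotated path belong to the stem; w of them are forbidden for the
       out-neighbours of y. *)
    have "int j0 \<le> int b - w"
    proof -
      have "{i. i < b \<and> E y (stem ! i)} \<subseteq> {..<b} - {s - L..<b - t}"
      proof
        fix x assume x: "x \<in> {i. i < b \<and> E y (stem ! i)}"
        then have "Q i0 ! (L + x) = stem ! x"
          by (simp add: Q_def nth_append L_def del: rotate_Suc)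
        then have "\<not> (s \<le> L + x \<and> L + x + t < ?n)"
          using Q_out[OF i0, of "L + x"] x nL by auto
        then show "x \<in> {..<b} - {s - L..<b - t}" using x nL by auto
      qed
      then have "j0 \<le> card ({..<b} - {s - L..<b - t})"
        unfolding j0_def by (intro card_mono) auto
      also have "\<dots> = b - (b - t - (s - L))"
        by (subst card_Diff_subset) auto
      finally show ?thesis using bs nL j0 unfolding w_def by linarith
    qed
    moreover have "period_card (int L) A + period_card (int L) J + int b - 1 \<le> int L"
      by (rule period_card_window_le[OF per _ _ ne avoid1]) (use L0 b0 in auto)
    ultimately show False unfolding den w_def using a jj st nL b0 by linarith
  qed
qed

text \<open>Paths with fewer than $2d - 1$ arcs are subpaths of those with exactly $2d - 1$ arcs,
  and for an odd number of arcs the two blocks have different lengths, so by symmetry the first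
  one is the longer.\<close>

theorem two_block_path_exists:
  assumes "s + t < 2 * d"
  shows "two_block_path V E s t"
proof -
  define t' where "t' = 2 * d - 1 - s"
  have t': "s + t' + 1 = 2 * d" "t \<le> t'" using assms by (auto simp: t'_def)
  have "two_block_path V E s t'"
  proof (cases "t' < s")
    case True
    then show ?thesis using two_block_path_exact t' by blast
  next
    case False
    then have "s < t'" using t' by presburger
    then show ?thesis
      using two_block_path_exact[of t' s] t' two_block_path_commute by (simp add: add.commute)
  qed
  then show ?thesis using two_block_path_mono t' by blast
qed

end

section \<open>From relations to digraphs\<close>

lemma contains_copy_P_path:
  assumes "wf_digraph D" "two_block_path (verts D) (\<lambda>u v. (u, v) \<in> arcs_ends D) s t"
  shows "contains_copy D (P_path s t)"
proof -
  interpret D: wf_digraph D by fact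
  let ?P = "P_path s t"
  obtain u where u: "inj_on u {0..s + t}" "u ` {0..s + t} \<subseteq> verts D"
    "\<forall>i<s. (u i, u (Suc i)) \<in> arcs_ends D"
    "\<forall>i. s \<le> i \<and> i < s + t \<longrightarrow> (u (Suc i), u i) \<in> arcs_ends D"
    using assms(2) unfolding two_block_path_def by blast
  have P_arcs: "fst p \<le> s + t \<and> snd p \<le> s + t \<and> (u (fst p), u (snd p)) \<in> arcs_ends D"
    if "p \<in> arcs ?P" for p
  proof -
    consider i where "p = (i - 1, i)" "1 \<le> i" "i \<le> s"
      | i where "p = (i, i - 1)" "s + 1 \<le> i" "i \<le> s + t"
      using \<open>p \<in> arcs ?P\<close> unfolding P_path_def by auto
    then show ?thesis
    proof cases
      case 1
      then show ?thesis using u(3)[rule_format, of "i - 1"] by simp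
    next
      case 2
      then have "s \<le> i - 1 \<and> i - 1 < s + t" by linarith
      then show ?thesis using 2 u(4)[rule_format, of "i - 1"] by auto
    qed
  qed
  (* An isomorphism also maps arcs, so an arc of D is chosen for every pair of ends. *)
  define arc where "arc p = (SOME e. e \<in> arcs D \<and> tail D e = u (fst p) \<and> head D e = u (snd p))" for p
  have arc: "arc p \<in> arcs D \<and> tail D (arc p) = u (fst p) \<and> head D (arc p) = u (snd p)"
    if "p \<in> arcs ?P" for p
    unfolding arc_def
    by (rule someI_ex) (use P_arcs[OF that] in \<open>auto simp: arcs_ends_def arc_to_ends_def\<close>)
  have "inj_on arc (arcs ?P)"
  proof (rule inj_onI)
    fix p q assume pq: "p \<in> arcs ?P" "q \<in> arcs ?P" "arc p = arc q"
    then have "u (fst p) = u (fst q)" "u (snd p) = u (snd q)"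
      using arc[OF pq(1)] arc[OF pq(2)] by auto
    then have "fst p = fst q" "snd p = snd q"
      using P_arcs[OF pq(1)] P_arcs[OF pq(2)]
      by (auto intro: inj_onD[OF u(1)])
    then show "p = q" by (rule prod_eqI)
  qed
  define h where "h = \<lparr>iso_verts = u, iso_arcs = arc, iso_head = head D, iso_tail = tail D\<rparr>"
  have ends: "tail ?P = fst" "head ?P = snd" "verts ?P = {0..s + t}"
    by (simp_all add: P_path_def)
  have "wf_digraph ?P"
    using P_arcs by unfold_locales (auto simp: ends)
  then have iso: "pre_digraph.digraph_isomorphism ?P h"
    using u(1) \<open>inj_on arc (arcs ?P)\<close> arc
    by (auto simp: pre_digraph.digraph_isomorphism_def h_def ends)
  have "wf_digraph (app_iso h ?P)"
    using arc P_arcs by unfold_locales (auto simp: app_iso_def h_def ends)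
  then have "subgraph (app_iso h ?P) D"
    unfolding subgraph_def compatible_def
    using u(2) arc D.wf_digraph by (auto simp: app_iso_def h_def ends)
  then show ?thesis
    unfolding contains_copy_def digraph_iso_def using iso by blast
qed

lemma (in oriented_graph) oriented_min_degree:
  assumes "1 \<le> min_semi_degree G"
  shows "oriented_min_degree (verts G) (\<lambda>u v. (u, v) \<in> arcs_ends G) (min_semi_degree G)"
proof
  fix u v assume uv: "(u, v) \<in> arcs_ends G"
  show "u \<in> verts G \<and> v \<in> verts G" using uv by (auto simp: arcs_ends_conv)
  have "u \<noteq> v" using uv no_loops by (auto simp: arcs_ends_conv)
  then show "(v, u) \<notin> arcs_ends G" using uv no_two_cycle by blast
next
  fix v assume v: "v \<in> verts G"
  have "min_semi_degree G \<le> out_degree G v" "min_semi_degree G \<le> in_degree G v"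
    using v unfolding min_semi_degree_def min_out_degree_def min_in_degree_def
    by (auto intro: min.coboundedI1 min.coboundedI2)
  then show "min_semi_degree G \<le> card {u. (v, u) \<in> arcs_ends G}"
    "min_semi_degree G \<le> card {u. (u, v) \<in> arcs_ends G}"
    by (simp_all add: out_degree_eq_card_neighbours in_degree_eq_card_neighbours)
qed (use assms verts_nonempty in auto)

theorem theorem4:
  fixes k :: int and D :: "('a, 'b) pre_digraph"
  assumes "oriented_graph D"
    and "real (min_semi_degree D) > real_of_int k / 2"
  shows "\<forall>s t :: nat. int s + int t = k \<longrightarrow> contains_copy D (P_path s t)"
proof (intro allI impI)
  fix s t :: nat
  assume k: "int s + int t = k"
  interpret oriented_graph D by fact
  have "real_of_int k = real (s + t)" using k by (metis of_int_of_nat_eq of_nat_add)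
  then have less: "s + t < 2 * min_semi_degree D" using assms(2) by simp
  then have "1 \<le> min_semi_degree D" by simp
  then interpret R: oriented_min_degree "verts D" "\<lambda>u v. (u, v) \<in> arcs_ends D" "min_semi_degree D"
    by (rule oriented_min_degree)
  show "contains_copy D (P_path s t)"
    by (rule contains_copy_P_path[OF wf_digraph R.two_block_path_exists[OF less]])
qed

end
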